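(* Let $n\in\mathbb{N}$ and let $a_1,\ldots,a_n$ be positive real numbers. Then for all real $s,t$ with $3n+4<s<t$, \[ \dim_{\mathrm{H}}\left\{\alpha\in[s,t] : y=a_1x_1+\cdots+a_nx_n \text{ has infinitely many non-trivial solutions } (y,x_1,\ldots,x_n)\in\mathrm{PS}(\alpha)^{n+1}\right\}\le \frac{3n}{s-4}. \] In particular, for almost every $\alpha>3n+4$ (with respect to Lebesgue measure), the equation $y=a_1x_1+\cdots+a_nx_n$ has at most finitely many non-trivial solutions $(y,x_1,\ldots,x_n)\in\mathrm{PS}(\alpha)^{n+1}$.
   Context: For real $\alpha>1$, $\mathrm{PS}(\alpha)=\{\lfloor n^\alpha\rfloor : n\in\mathbb{N}\}$, where $\lfloor x\rfloor$ is the integer part of $x$. $\dim_{\mathrm{H}}$ denotes Hausdorff dimension. For the equation $y=a_1x_1+\cdots+a_nx_n$: if $a_1+\cdots+a_n=1$, a solution with $y=x_1=\cdots=x_n$ is called trivial and all other solutions are non-trivial; if $a_1+\cdots+a_n\ne 1$, all solutions are called non-trivial. *)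

theory Defs
  imports "HOL-Analysis.Analysis"
begin

section \<open>Hausdorff dimension\<close>

text \<open>
  The conventions are the usual ones: the empty set contributes 0 for every exponent, and a
  nonempty set contributes \<open>1\<close> for exponent 0. The latter has to be stated separately
  because \<open>0 powr 0 = 0\<close>.
\<close>

definition hausdorff_gauge :: "real \<Rightarrow> 'a::metric_space set \<Rightarrow> ennreal" where
  "hausdorff_gauge d U =
     (if U = {} then 0 else if d = 0 then 1 else ennreal (diameter U powr d))"

text \<open>
  Boundedness is required explicitly since \<^const>\<open>diameter\<close> is real-valued and
  has no meaningful value on unbounded sets. Finite covers are included by padding with
  empty sets.
\<close>

definition hausdorff_premeasure ::
  "real \<Rightarrow> real \<Rightarrow> 'a::metric_space set \<Rightarrow> ennreal" where
  "hausdorff_premeasure \<delta> d S =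
     (INF U \<in> {U :: nat \<Rightarrow> 'a set. S \<subseteq> (\<Union>i. U i) \<and>
                 (\<forall>i. bounded (U i) \<and> diameter (U i) \<le> \<delta>)}.
        \<Sum>i. hausdorff_gauge d (U i))"

definition hausdorff_measure :: "real \<Rightarrow> 'a::metric_space set \<Rightarrow> ennreal" where
  "hausdorff_measure d S = (SUP \<delta> \<in> {0<..}. hausdorff_premeasure \<delta> d S)"

definition hausdorff_dim :: "'a::metric_space set \<Rightarrow> ennreal" where
  "hausdorff_dim S = Inf {ennreal d | d. 0 \<le> d \<and> hausdorff_measure d S = 0}"

section \<open>Linear equations in Piatetski-Shapiro sequences\<close>

definition PS :: "real \<Rightarrow> int set" where
  "PS \<alpha> = {\<lfloor>real m powr \<alpha>\<rfloor> | m :: nat. m \<ge> 1}"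

text \<open>
  A tuple \<open>(x\<^sub>1, \<dots>, x\<^sub>n)\<close> is a function on \<open>{1..n}\<close> that is extensional
  (fixed to \<^const>\<open>undefined\<close> elsewhere), so that counting such functions counts tuples.
\<close>

definition PS_solutions ::
  "real \<Rightarrow> nat \<Rightarrow> (nat \<Rightarrow> real) \<Rightarrow> (int \<times> (nat \<Rightarrow> int)) set" where
  "PS_solutions \<alpha> n a =
     {(y, x). y \<in> PS \<alpha> \<and> x \<in> {1..n} \<rightarrow>\<^sub>E PS \<alpha> \<and>
              real_of_int y = (\<Sum>i=1..n. a i * real_of_int (x i))}"

definition trivial_solution ::
  "nat \<Rightarrow> (nat \<Rightarrow> real) \<Rightarrow> int \<times> (nat \<Rightarrow> int) \<Rightarrow> bool" where
  "trivial_solution n a = (\<lambda>(y, x). (\<Sum>i=1..n. a i) = 1 \<and> (\<forall>i\<in>{1..n}. x i = y))"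

definition nontrivial_PS_solutions ::
  "real \<Rightarrow> nat \<Rightarrow> (nat \<Rightarrow> real) \<Rightarrow> (int \<times> (nat \<Rightarrow> int)) set" where
  "nontrivial_PS_solutions \<alpha> n a = {p \<in> PS_solutions \<alpha> n a. \<not> trivial_solution n a p}"

end

(* Put r_i = q_i / p. A solution y = floor (p^alpha), x_i = floor (q_i^alpha) makes
   G alpha = (SUM i. a_i * r_i^alpha) differ from 1 by O(p^-s). Since all a_i are positive, G is
   convex, and nontriviality yields some q_j ~= p with r_j bounded away from 0, so that
   G'' >= const * (ln r_j)^2 >= const * p^-2. Hence the parameters belonging to (p, q) with
   G' >= 0 lie in a set of diameter O(p^(-(s-2)/2)), and so do those with G' < 0; for n = 1 the
   first derivative even gives O(p^-(s-1)). There are O(p^n) tuples q for each p, so the natural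
   cover of the limsup set is summable in exponent d as soon as n + 1 < d * (s - 2) / 2
   (n + 1 < d * (s - 1) if n = 1), which covers every d >= 3n / (s - 4). *)

theory Submission
  imports Defs
begin

section \<open>Null sets for Hausdorff measures\<close>

lemma hausdorff_measure_eq_0I:
  assumes "\<And>\<delta> \<epsilon>. 0 < \<delta> \<Longrightarrow> 0 < \<epsilon> \<Longrightarrow> \<exists>U :: nat \<Rightarrow> 'a::metric_space set. S \<subseteq> (\<Union>i. U i) \<and>
    (\<forall>i. bounded (U i) \<and> diameter (U i) \<le> \<delta>) \<and> (\<Sum>i. hausdorff_gauge d (U i)) \<le> ennreal \<epsilon>"
  shows "hausdorff_measure d S = 0"
proof -
  have "hausdorff_premeasure \<delta> d S = 0" if "\<delta> > 0" for \<delta>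
  proof -
    have "hausdorff_premeasure \<delta> d S \<le> 0 + ennreal \<epsilon>" if \<epsilon>: "\<epsilon> > 0" for \<epsilon>
    proof -
      obtain U where "S \<subseteq> (\<Union>i. U i)" "\<forall>i. bounded (U i) \<and> diameter (U i) \<le> \<delta>"
          and le: "(\<Sum>i. hausdorff_gauge d (U i)) \<le> ennreal \<epsilon>"
        using assms[OF \<open>\<delta> > 0\<close> \<epsilon>] by blast
      then have "hausdorff_premeasure \<delta> d S \<le> (\<Sum>i. hausdorff_gauge d (U i))"
        unfolding hausdorff_premeasure_def by (intro INF_lower) blast
      also note le
      finally show ?thesis by simp
    qed
    then have "hausdorff_premeasure \<delta> d S \<le> 0"
      by (rule ennreal_le_epsilon)
    then show ?thesis by simp
  qed
  then show ?thesis
    unfolding hausdorff_measure_def by simp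
qed

lemma hausdorff_measure_eq_0E:
  fixes S :: "'a::metric_space set"
  assumes "hausdorff_measure d S = 0" "0 < \<delta>" "0 < \<epsilon>"
  obtains U where "S \<subseteq> (\<Union>i::nat. U i)" "\<And>i. bounded (U i)" "\<And>i. diameter (U i) \<le> \<delta>"
    "(\<Sum>i. hausdorff_gauge d (U i)) < ennreal \<epsilon>"
proof -
  have "hausdorff_premeasure \<delta> d S \<le> hausdorff_measure d S"
    unfolding hausdorff_measure_def using assms by (intro SUP_upper) auto
  then have "hausdorff_premeasure \<delta> d S < ennreal \<epsilon>"
    using assms by (simp add: ennreal_less_zero_iff)
  then show ?thesis
    unfolding hausdorff_premeasure_def INF_less_iff using that by blast
qed

lemma hausdorff_measure_eq_0_subset:
  assumes "hausdorff_measure d T = 0" "S \<subseteq> T"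
  shows "hausdorff_measure d S = 0"
proof -
  have "hausdorff_measure d S \<le> hausdorff_measure d T"
    unfolding hausdorff_measure_def hausdorff_premeasure_def
    using assms(2) by (intro SUP_mono' INF_superset_mono) auto
  then show ?thesis using assms(1) by simp
qed

text \<open>Positivity of \<open>d\<close> keeps clear of the convention for exponent 0 and makes
  \<open>powr\<close> monotone in its base.\<close>

lemma hausdorff_gauge_le_powr:
  assumes "0 < d" "diameter U \<le> r" "bounded U"
  shows "hausdorff_gauge d U \<le> ennreal (r powr d)"
  using assms diameter_ge_0[of U] by (auto simp: hausdorff_gauge_def intro!: ennreal_leI powr_mono2)

lemma hausdorff_dim_le:
  assumes "0 \<le> d" "hausdorff_measure d S = 0"
  shows "hausdorff_dim S \<le> ennreal d"
  unfolding hausdorff_dim_def using assms by (intro Inf_lower) auto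

text \<open>The convergence half of Borel-Cantelli: a point of \<open>S\<close> is covered by
  infinitely many of the families, so every tail of the families covers \<open>S\<close>, and tails
  of the convergent series give arbitrarily small gauge sums.\<close>

lemma hausdorff_measure_limsup_eq_0:
  fixes \<V> :: "nat \<Rightarrow> 'a::metric_space set set"
  assumes d: "0 < d"
    and fin: "\<And>p. finite (\<V> p)"
    and \<V>: "\<And>p V. V \<in> \<V> p \<Longrightarrow> bounded V \<and> diameter V \<le> \<rho> p"
    and \<rho>: "\<rho> \<longlonglongrightarrow> 0"
    and sum: "summable (\<lambda>p. real (card (\<V> p)) * \<rho> p powr d)"
    and S: "\<And>x. x \<in> S \<Longrightarrow> infinite {p. x \<in> \<Union>(\<V> p)}"
  shows "hausdorff_measure d S = 0"
proof (rule hausdorff_measure_eq_0I)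
  fix \<delta> \<epsilon> :: real assume "0 < \<delta>" "0 < \<epsilon>"
  let ?f = "\<lambda>p. real (card (\<V> p)) * \<rho> p powr d"
  obtain P1 where P1: "\<And>p. p \<ge> P1 \<Longrightarrow> norm (\<Sum>i. ?f (i + p)) < \<epsilon>"
    using suminf_exist_split[OF \<open>0 < \<epsilon>\<close> sum] by blast
  obtain P2 where P2: "\<And>p. p \<ge> P2 \<Longrightarrow> \<rho> p < \<delta>"
    using order_tendstoD(2)[OF \<rho> \<open>0 < \<delta>\<close>] by (auto simp: eventually_sequentially)
  define P where "P = max P1 P2"
  have "\<exists>h. bij_betw h {0..<card (\<V> p)} (\<V> p)" for p
    by (rule ex_bij_betw_nat_finite[OF fin])
  then obtain h where h: "\<And>p. bij_betw (h p) {0..<card (\<V> p)} (\<V> p)"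
    by metis
  \<comment> \<open>Row \<open>p\<close> enumerates the family with index \<open>p + P\<close>,
    padded with empty sets, whose gauge is 0; \<open>prod_decode\<close> then flattens the rows into
    one sequence.\<close>
  define W where "W = (\<lambda>(p, k). if k < card (\<V> (p + P)) then h (p + P) k else {})"
  have hW: "h p k \<in> \<V> p" if "k < card (\<V> p)" for p k
    using h[of p] that by (auto simp: bij_betw_def)
  have W: "bounded (W x)" "diameter (W x) \<le> \<delta>" for x
    using \<V>[OF hW[of "snd x" "fst x + P"]] P2[of "fst x + P", THEN less_imp_le] \<open>0 < \<delta>\<close>
    by (auto simp: W_def P_def intro: order_trans split: prod.splits)
  have "S \<subseteq> (\<Union>i. W (prod_decode i))"
  proof
    fix x assume "x \<in> S"
    then obtain p where "p \<ge> P" "x \<in> \<Union>(\<V> p)"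
      using S[of x] unfolding infinite_nat_iff_unbounded_le by blast
    then obtain V where "V \<in> h p ` {0..<card (\<V> p)}" "x \<in> V"
      using h[of p] by (metis UnionE bij_betw_imp_surj_on)
    then obtain k where "k < card (\<V> p)" "x \<in> h p k"
      by auto
    then have "x \<in> W (prod_decode (prod_encode (p - P, k)))"
      using \<open>p \<ge> P\<close> by (simp add: W_def)
    then show "x \<in> (\<Union>i. W (prod_decode i))" by blast
  qed
  moreover have "(\<Sum>i. hausdorff_gauge d (W (prod_decode i))) \<le> ennreal \<epsilon>"
  proof -
    have "(\<Sum>i. hausdorff_gauge d (W (prod_decode i))) = (\<Sum>p. \<Sum>k. hausdorff_gauge d (W (p, k)))"
      by (rule suminf_ennreal_2dimen) auto
    also have "\<dots> \<le> (\<Sum>p. ennreal (?f (p + P)))"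
    proof (intro suminf_le summableI)
      fix p
      have "(\<Sum>k. hausdorff_gauge d (W (p, k))) = (\<Sum>k<card (\<V> (p + P)). hausdorff_gauge d (W (p, k)))"
        by (rule suminf_finite) (auto simp: W_def hausdorff_gauge_def)
      also have "\<dots> \<le> (\<Sum>k<card (\<V> (p + P)). ennreal (\<rho> (p + P) powr d))"
        using \<V>[OF hW[of _ "p + P"]] by (intro sum_mono hausdorff_gauge_le_powr d) (auto simp: W_def)
      also have "\<dots> = ennreal (?f (p + P))"
        by (simp add: ennreal_mult ennreal_of_nat_eq_real_of_nat)
      finally show "(\<Sum>k. hausdorff_gauge d (W (p, k))) \<le> ennreal (?f (p + P))" .
    qed
    also have "\<dots> = ennreal (\<Sum>p. ?f (p + P))"
      by (intro suminf_ennreal2 summable_ignore_initial_segment sum) simp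
    also have "\<dots> \<le> ennreal \<epsilon>"
    proof (rule ennreal_leI)
      have "norm (\<Sum>p. ?f (p + P)) < \<epsilon>" by (rule P1) (simp add: P_def)
      then show "(\<Sum>p. ?f (p + P)) \<le> \<epsilon>" unfolding real_norm_def by linarith
    qed
    finally show ?thesis .
  qed
  ultimately show "\<exists>U :: nat \<Rightarrow> 'a set. S \<subseteq> (\<Union>i. U i) \<and>
      (\<forall>i. bounded (U i) \<and> diameter (U i) \<le> \<delta>) \<and> (\<Sum>i. hausdorff_gauge d (U i)) \<le> ennreal \<epsilon>"
    using W by (intro exI[of _ "\<lambda>i. W (prod_decode i)"] conjI allI) assumption+
qed

section \<open>Comparison with Lebesgue null sets\<close>

lemma bounded_real_subset_interval:
  fixes U :: "real set"
  assumes "bounded U"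
  shows "\<exists>l. U \<subseteq> {l - diameter U..l + diameter U}"
proof (cases "U = {}")
  case False
  then obtain l where l: "l \<in> U" by blast
  have "l - diameter U \<le> x \<and> x \<le> l + diameter U" if "x \<in> U" for x
    using diameter_bounded_bound[OF assms l that] by (simp add: dist_real_def abs_le_iff)
  then show ?thesis by (auto intro: exI[of _ l])
qed simp

text \<open>For exponent 1 the gauge of a nonempty set is its diameter, and the set fits into an
  interval of twice that length. A cover with gauge sum below \<open>e / 2\<close> thus becomes one
  by intervals of total length at most \<open>e\<close>.\<close>

lemma negligible_if_hausdorff_measure_1_eq_0:
  fixes S :: "real set"
  assumes "hausdorff_measure 1 S = 0"
  shows "negligible S"
  unfolding negligible_outer_le
proof (intro allI impI)
  fix e :: real assume "0 < e"
  then obtain U where U: "S \<subseteq> (\<Union>i::nat. U i)" "\<And>i. bounded (U i)"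
      "(\<Sum>i. hausdorff_gauge 1 (U i)) < ennreal (e / 2)"
    using hausdorff_measure_eq_0E[OF assms zero_less_one, of "e / 2"] by (metis half_gt_zero)
  obtain l where l: "\<And>i. U i \<subseteq> {l i - diameter (U i)..l i + diameter (U i)}"
    using bounded_real_subset_interval[OF U(2)] by metis
  define T where "T i = (if U i = {} then {} else {l i - diameter (U i)..l i + diameter (U i)})" for i
  have T: "emeasure lebesgue (T i) = 2 * hausdorff_gauge 1 (U i)" for i
    using diameter_ge_0[OF U(2), of i] 
    by (auto simp: T_def hausdorff_gauge_def ennreal_mult)
  have "emeasure lebesgue (\<Union>i. T i) \<le> (\<Sum>i. emeasure lebesgue (T i))"
    by (rule emeasure_subadditive_countably) (auto simp: T_def)
  also have "\<dots> = 2 * (\<Sum>i. hausdorff_gauge 1 (U i))"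
    by (simp add: T)
  also have "\<dots> \<le> 2 * ennreal (e / 2)"
    using U(3) by (intro mult_left_mono) auto
  also have "\<dots> = ennreal e"
    using \<open>0 < e\<close> ennreal_mult[of 2 "e / 2"] by simp
  finally have le: "emeasure lebesgue (\<Union>i. T i) \<le> ennreal e" .
  have "(\<Union>i. T i) \<in> sets lebesgue"
    by (intro sets.countable_UN) (auto simp: T_def)
  moreover have "S \<subseteq> (\<Union>i. T i)"
  proof
    fix x assume "x \<in> S"
    then obtain i where "x \<in> U i" using U(1) by blast
    then have "x \<in> T i" using l[of i] by (auto simp: T_def)
    then show "x \<in> (\<Union>i. T i)" by blast
  qed
  moreover have "emeasure lebesgue (\<Union>i. T i) < \<infinity>"
    using le by (rule le_less_trans) simp
  moreover have "measure lebesgue (\<Union>i. T i) \<le> e"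
    unfolding measure_def using le \<open>0 < e\<close> by (intro enn2real_leI) auto
  ultimately show "\<exists>T. S \<subseteq> T \<and> T \<in> lmeasurable \<and> measure lebesgue T \<le> e"
    by (intro exI[of _ "\<Union>i. T i"] conjI fmeasurableI)
qed

section \<open>Convexity of weighted sums of powers\<close>

text \<open>Taylor's formula of order 2: the remainder is \<open>exp x / 2 * u^2\<close> with
  \<open>\<bar>x\<bar> \<le> \<bar>u\<bar> \<le> U\<close>, hence
  \<open>exp x \<ge> exp (- U)\<close>.\<close>

lemma exp_ge_quadratic:
  fixes u U :: real
  assumes "\<bar>u\<bar> \<le> U"
  shows "1 + u + exp (- U) / 2 * u\<^sup>2 \<le> exp u"
proof -
  obtain x where x: "\<bar>x\<bar> \<le> \<bar>u\<bar>" "exp u = (\<Sum>m<2. u ^ m / fact m) + exp x / fact 2 * u ^ 2"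
    using Maclaurin_exp_le[of u 2] by blast
  have "exp (- U) / 2 * u\<^sup>2 \<le> exp x / 2 * u\<^sup>2"
    using x(1) assms by (intro mult_right_mono divide_right_mono) auto
  then show ?thesis
    using x(2) by (simp add: lessThan_nat_numeral numeral_2_eq_2)
qed

text \<open>With \<open>r i = q i / p\<close> this is the function G of the overview.\<close>

definition power_sum :: "'i set \<Rightarrow> ('i \<Rightarrow> real) \<Rightarrow> ('i \<Rightarrow> real) \<Rightarrow> real \<Rightarrow> real" where
  "power_sum I a r \<alpha> = (\<Sum>i\<in>I. a i * r i powr \<alpha>)"

definition power_sum_deriv :: "'i set \<Rightarrow> ('i \<Rightarrow> real) \<Rightarrow> ('i \<Rightarrow> real) \<Rightarrow> real \<Rightarrow> real" where
  "power_sum_deriv I a r \<alpha> = (\<Sum>i\<in>I. a i * (ln (r i) * r i powr \<alpha>))"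

text \<open>Each term at \<beta> is its value at \<alpha> times \<open>exp (u i)\<close>. Since the
  weights are positive, \<open>1 + u \<le> exp u\<close> puts every term above its tangent, and the
  single index \<open>j\<close> supplies the quadratic surplus.\<close>

lemma power_sum_strongly_convex:
  assumes "finite I" "j \<in> I"
    and a: "\<And>i. i \<in> I \<Longrightarrow> 0 < a i" and r: "\<And>i. i \<in> I \<Longrightarrow> 0 < r i"
    and U: "\<bar>(\<beta> - \<alpha>) * ln (r j)\<bar> \<le> U"
  shows "power_sum I a r \<alpha> + (\<beta> - \<alpha>) * power_sum_deriv I a r \<alpha>
      + a j * r j powr \<alpha> * (exp (- U) / 2 * ((\<beta> - \<alpha>) * ln (r j))\<^sup>2) \<le> power_sum I a r \<beta>"
proof -
  define u where "u i = (\<beta> - \<alpha>) * ln (r i)" for i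
  define w where "w i = a i * r i powr \<alpha>" for i
  define X where "X = exp (- U) / 2 * (u j)\<^sup>2"
  have w: "0 < w i" if "i \<in> I" for i
    using a[OF that] r[OF that] by (simp add: w_def)
  have *: "a i * r i powr \<beta> = w i * exp (u i)" if "i \<in> I" for i
    using r[OF that] by (simp add: w_def u_def powr_def algebra_simps flip: exp_add)
  have "w i * (1 + u i) + (if i = j then w j * X else 0) \<le> a i * r i powr \<beta>" if "i \<in> I" for i
  proof (cases "i = j")
    case True
    have "w j * (1 + u j + X) \<le> w j * exp (u j)"
      using exp_ge_quadratic[of "u j" U] U w[OF \<open>j \<in> I\<close>]
      by (intro mult_left_mono) (auto simp: X_def u_def)
    then show ?thesis
      using True *[OF \<open>j \<in> I\<close>] by (simp add: algebra_simps)
  next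
    case False
    have "w i * (1 + u i) \<le> w i * exp (u i)"
      using w[OF that] by (intro mult_left_mono exp_ge_add_one_self) auto
    then show ?thesis
      using False *[OF that] by simp
  qed
  then have "(\<Sum>i\<in>I. w i * (1 + u i) + (if i = j then w j * X else 0)) \<le> power_sum I a r \<beta>"
    unfolding power_sum_def by (rule sum_mono)
  also have "(\<Sum>i\<in>I. w i * (1 + u i) + (if i = j then w j * X else 0))
      = (\<Sum>i\<in>I. w i) + (\<Sum>i\<in>I. w i * u i) + w j * X"
    using \<open>finite I\<close> \<open>j \<in> I\<close> by (simp add: sum.distrib algebra_simps)
  also have "(\<Sum>i\<in>I. w i * u i) = (\<beta> - \<alpha>) * power_sum_deriv I a r \<alpha>"
    by (simp add: power_sum_deriv_def sum_distrib_left w_def u_def mult_ac)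
  finally show ?thesis
    by (simp add: power_sum_def w_def X_def u_def)
qed

text \<open>Distinct integers differ by at least 1, so \<open>ln x \<le> x - 1\<close>, applied to
  whichever of \<open>p / q\<close> and \<open>q / p\<close> is below 1, yields the reciprocal of
  the larger integer, which is at most \<open>K * p\<close>.\<close>

lemma abs_ln_ratio_ge:
  fixes p q :: nat
  assumes "1 \<le> p" "1 \<le> q" "p \<noteq> q" "real q \<le> K * real p" "1 \<le> K"
  shows "1 / (K * real p) \<le> \<bar>ln (real q / real p)\<bar>"
proof (cases "p < q")
  case True
  have "1 / (K * real p) \<le> 1 / real q"
    using assms by (intro divide_left_mono) auto
  also have "\<dots> \<le> 1 - real p / real q"
    using True by (simp add: field_simps)
  also have "\<dots> \<le> - ln (real p / real q)"
    using ln_le_minus_one[of "real p / real q"] assms by simp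
  also have "\<dots> \<le> \<bar>ln (real q / real p)\<bar>"
    using assms by (simp add: ln_div)
  finally show ?thesis .
next
  case False
  have "1 / (K * real p) \<le> 1 / real p"
    using assms by (intro divide_left_mono) auto
  also have "\<dots> \<le> 1 - real q / real p"
    using False assms by (simp add: field_simps)
  also have "\<dots> \<le> - ln (real q / real p)"
    using ln_le_minus_one[of "real q / real p"] assms by simp
  finally show ?thesis by simp
qed

text \<open>Above 1, \<open>r\<close> is bounded by \<open>K\<close>; below 1, the exponent \<alpha>
  \<ge> 1 only shrinks it, so \<open>c \<le> r\<close>. Both \<open>ln K\<close> and
  \<open>- ln c\<close> are nonnegative, so their sum serves both cases.\<close>

lemma abs_ln_le_of_powr_ge:
  fixes c r K \<alpha> :: real
  assumes "0 < c" "c \<le> 1" "0 < r" "r \<le> K" "1 \<le> K" "1 \<le> \<alpha>" "c \<le> r powr \<alpha>"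
  shows "\<bar>ln r\<bar> \<le> ln K - ln c"
proof (cases "1 \<le> r")
  case True
  have "ln r \<le> ln K" and "ln c \<le> 0" and "0 \<le> ln r" using assms True by simp_all
  then show ?thesis by linarith
next
  case False
  have "c \<le> r powr 1"
    using assms False powr_mono'[of 1 \<alpha> r] by auto
  then have "ln c \<le> ln r" and "ln r \<le> 0" and "0 \<le> ln K"
    using assms False by simp_all
  then show ?thesis by linarith
qed

text \<open>Strong convexity bounds the distance to any \<open>\<beta>\<close> on the side of \<open>\<alpha>\<close> on which the sum
  increases; with a single summand the first derivative already does so, with a better exponent.\<close>

lemma near_solutions_close:
  fixes p :: nat and q :: "'i \<Rightarrow> nat"
  defines "r \<equiv> \<lambda>i. real (q i) / real p"
  assumes I: "finite I" "j \<in> I" and a: "\<And>i. i \<in> I \<Longrightarrow> 0 < a i" and b: "0 < b" "b \<le> a j"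
    and p: "1 \<le> p" and q: "\<And>i. i \<in> I \<Longrightarrow> 1 \<le> q i"
    and K: "1 \<le> K" "real (q j) \<le> K * real p" and j: "q j \<noteq> p" "c \<le> r j powr \<alpha>"
    and c: "0 < c" "c \<le> 1" and s: "1 \<le> s" "\<alpha> \<in> {s..t}" "\<beta> \<in> {s..t}"
    and D: "\<bar>power_sum I a r \<alpha> - 1\<bar> \<le> D * real p powr - s"
      "\<bar>power_sum I a r \<beta> - 1\<bar> \<le> D * real p powr - s"
    and side: "0 \<le> (\<beta> - \<alpha>) * power_sum_deriv I a r \<alpha>"
  shows "(\<beta> - \<alpha>)\<^sup>2 \<le> 4 * D * K\<^sup>2 * exp ((t - s) * (ln K - ln c)) / (b * c) * real p powr (2 - s)"
    and "I = {j} \<Longrightarrow> \<bar>\<beta> - \<alpha>\<bar> \<le> 2 * D * K / (b * c) * real p powr (1 - s)"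
proof -
  define L where "L = ln (r j)"
  \<comment> \<open>A bound for \<open>\<bar>(\<beta> - \<alpha>) * ln (r j)\<bar>\<close> that
    depends on neither \<open>p\<close> nor \<open>q\<close>, so the convexity constant is uniform
    over all tuples.\<close>
  define U where "U = (t - s) * (ln K - ln c)"
  define \<Delta> where "\<Delta> = \<bar>\<beta> - \<alpha>\<bar>"
  have r: "0 < r i" if "i \<in> I" for i
    using q[OF that] p by (simp add: r_def)
  have L_ge: "1 / (K * real p) \<le> \<bar>L\<bar>"
    unfolding L_def r_def using p q[OF I(2)] j K by (intro abs_ln_ratio_ge) auto
  have L_le: "\<bar>L\<bar> \<le> ln K - ln c"
    unfolding L_def using c r[OF I(2)] K s j p
    by (intro abs_ln_le_of_powr_ge[where \<alpha> = \<alpha>]) (auto simp: r_def field_simps)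
  have "\<Delta> \<le> t - s" using s by (auto simp: \<Delta>_def)
  then have "\<Delta> * \<bar>L\<bar> \<le> U"
    unfolding U_def using L_le s by (intro mult_mono) auto
  then have U: "\<bar>(\<beta> - \<alpha>) * ln (r j)\<bar> \<le> U"
    by (simp add: abs_mult \<Delta>_def L_def)
  have bc: "b * c \<le> a j * r j powr \<alpha>"
    using b c j by (intro mult_mono) auto
  have Kp: "0 < 1 / (K * real p)" using K p by auto
  have gap: "power_sum I a r \<beta> - power_sum I a r \<alpha> \<le> 2 * D * real p powr - s"
    using D by (simp add: abs_le_iff)
  \<comment> \<open>The lower bound \<open>1 / (K * p)\<close> for the logarithm enters squared;
    this is what turns \<open>p powr - s\<close> into \<open>p powr (2 - s)\<close>.\<close>
  have "b * c * (exp (- U) / 2 * (\<Delta> / (K * real p))\<^sup>2)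
      \<le> a j * r j powr \<alpha> * (exp (- U) / 2 * ((\<beta> - \<alpha>) * ln (r j))\<^sup>2)"
  proof (intro mult_mono bc)
    have "\<Delta> * (1 / (K * real p)) \<le> \<Delta> * \<bar>L\<bar>"
      using L_ge by (intro mult_left_mono) (auto simp: \<Delta>_def)
    then have "(\<Delta> / (K * real p))\<^sup>2 \<le> (\<Delta> * \<bar>L\<bar>)\<^sup>2"
      using K by (intro power_mono) (auto simp: \<Delta>_def)
    then show "(\<Delta> / (K * real p))\<^sup>2 \<le> ((\<beta> - \<alpha>) * ln (r j))\<^sup>2"
      by (simp add: \<Delta>_def L_def power_mult_distrib)
  qed (use b c a[OF I(2)] j in auto)
  \<comment> \<open>By \<open>side\<close> the tangent term is nonnegative, so the quadratic surplus
    alone is at most the difference of the two sums.\<close>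
  also have "\<dots> \<le> 2 * D * real p powr - s"
    using power_sum_strongly_convex[of I j a r \<beta> \<alpha> U, OF I a r U] side gap by linarith
  finally have "b * c * (exp (- U) / 2 * (\<Delta> / (K * real p))\<^sup>2) \<le> 2 * D * real p powr - s" .
  then have "\<Delta>\<^sup>2 \<le> 4 * D * K\<^sup>2 * exp U / (b * c) * (real p powr - s * (real p)\<^sup>2)"
    using b c K p by (simp add: field_simps exp_minus power2_eq_square)
  also have "real p powr - s * (real p)\<^sup>2 = real p powr (2 - s)"
    using p by (simp add: powr_add[symmetric] flip: powr_numeral)
  finally show "(\<beta> - \<alpha>)\<^sup>2 \<le> 4 * D * K\<^sup>2 * exp ((t - s) * (ln K - ln c)) / (b * c) * real p powr (2 - s)"
    by (simp add: \<Delta>_def U_def)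
  assume I_eq: "I = {j}"
  \<comment> \<open>With one summand nothing can cancel in the derivative, so its size is bounded
    below and the logarithm enters only to the first power.\<close>
  have "b * c * (\<Delta> * (1 / (K * real p))) \<le> a j * r j powr \<alpha> * (\<Delta> * \<bar>L\<bar>)"
    using a[OF I(2)] L_ge K by (intro mult_mono[OF bc] mult_left_mono) (auto simp: \<Delta>_def)
  also have "\<dots> = \<bar>(\<beta> - \<alpha>) * power_sum_deriv I a r \<alpha>\<bar>"
    using a[OF I(2)] by (simp add: power_sum_deriv_def I_eq abs_mult \<Delta>_def L_def)
  also have "\<dots> \<le> 2 * D * real p powr - s"
  proof -
    \<comment> \<open>This time the quadratic surplus is dropped and the tangent term is kept; by
      \<open>side\<close> it equals its absolute value.\<close>
    have "0 \<le> a j * r j powr \<alpha> * (exp (- U) / 2 * ((\<beta> - \<alpha>) * ln (r j))\<^sup>2)"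
      using a[OF I(2)] by simp
    then show ?thesis
      using power_sum_strongly_convex[of I j a r \<beta> \<alpha> U, OF I a r U] side gap by linarith
  qed
  finally have "\<Delta> \<le> 2 * D * K / (b * c) * (real p powr - s * real p)"
    using b c K p by (simp add: field_simps)
  also have "real p powr - s * real p = real p powr (1 - s)"
    using p powr_add[of "real p" "- s" 1] by simp
  finally show "\<bar>\<beta> - \<alpha>\<bar> \<le> 2 * D * K / (b * c) * real p powr (1 - s)"
    by (simp add: \<Delta>_def)
qed

section \<open>Size and spread of the coordinates of a solution\<close>

text \<open>Averaging over \<open>J\<close>. Dividing by \<open>card I\<close> instead of
  \<open>card J\<close> makes the bound independent of \<open>J\<close>.\<close>

lemma exists_large_term:
  fixes f :: "'i \<Rightarrow> real"
  assumes "finite I" "J \<subseteq> I" "0 < \<gamma>" "\<gamma> \<le> sum f J"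
  shows "\<exists>j\<in>J. \<gamma> / real (card I) \<le> f j"
proof (rule ccontr)
  assume "\<not> ?thesis"
  then have less: "\<And>j. j \<in> J \<Longrightarrow> f j < \<gamma> / real (card I)" by force
  have "J \<noteq> {}" "finite J" using assms finite_subset by auto
  then have "sum f J < (\<Sum>j\<in>J. \<gamma> / real (card I))"
    using less by (intro sum_strict_mono) auto
  also have "\<dots> = real (card J) / real (card I) * \<gamma>" by simp
  also have "\<dots> \<le> 1 * \<gamma>"
    using assms card_mono[of I J] by (intro mult_right_mono) (auto simp: divide_le_eq_1)
  finally show False using assms by simp
qed

text \<open>A finite set has finitely many subset sums, so the positive deficits have a positive
  minimum; \<open>J = {}\<close> contributes the deficit 1, so the minimum exists.\<close>

lemma subset_sum_gap:
  fixes a :: "'i \<Rightarrow> real"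
  assumes "finite I"
  shows "\<exists>\<gamma>>0. \<forall>J\<subseteq>I. sum a J < 1 \<longrightarrow> \<gamma> \<le> 1 - sum a J"
proof -
  define \<Gamma> where "\<Gamma> = (\<lambda>J. 1 - sum a J) ` {J. J \<subseteq> I \<and> sum a J < 1}"
  have "finite \<Gamma>" unfolding \<Gamma>_def using assms by simp
  moreover have "\<Gamma> \<noteq> {}" unfolding \<Gamma>_def by (auto intro: exI[of _ "{}"])
  ultimately have "0 < Min \<Gamma>" "\<forall>x\<in>\<Gamma>. Min \<Gamma> \<le> x" by (auto simp: \<Gamma>_def)
  then show ?thesis by (intro exI[of _ "Min \<Gamma>"]) (auto simp: \<Gamma>_def)
qed

text \<open>The coordinates equal to \<open>y\<close> can be cancelled; the total weight left over takes only finitely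
  many values, so it is bounded below and some remaining coordinate is comparable to \<open>y\<close>.\<close>

lemma exists_large_different_coordinate:
  fixes a :: "'i \<Rightarrow> real" and x :: "'i \<Rightarrow> real"
  assumes "finite I" "\<And>i. i \<in> I \<Longrightarrow> 0 < a i" "\<And>i. i \<in> I \<Longrightarrow> 0 < x i" "0 < y"
    and eq: "y = (\<Sum>i\<in>I. a i * x i)"
    and nontrivial: "\<not> (sum a I = 1 \<and> (\<forall>i\<in>I. x i = y))"
    and \<gamma>: "0 < \<gamma>" "\<And>J. J \<subseteq> I \<Longrightarrow> sum a J < 1 \<Longrightarrow> \<gamma> \<le> 1 - sum a J"
  shows "\<exists>j\<in>I. x j \<noteq> y \<and> \<gamma> * y / real (card I) \<le> a j * x j"
proof -
  define J where "J = {i\<in>I. x i = y}"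
  have J: "J \<subseteq> I" "finite (I - J)" using assms by (auto simp: J_def)
  have "y = (\<Sum>i\<in>I - J. a i * x i) + (\<Sum>i\<in>J. a i * x i)"
    using eq sum.subset_diff[OF J(1) \<open>finite I\<close>] by metis
  moreover have "(\<Sum>i\<in>J. a i * x i) = sum a J * y"
    by (simp add: J_def sum_distrib_right)
  ultimately have rest: "(\<Sum>i\<in>I - J. a i * x i) = (1 - sum a J) * y"
    by (simp add: algebra_simps)
  \<comment> \<open>If all coordinates equalled \<open>y\<close>, cancelling \<open>y\<close> would
    force total weight 1, that is, a trivial solution.\<close>
  have "I - J \<noteq> {}"
  proof
    assume "I - J = {}"
    then have "J = I" and "(\<Sum>i\<in>I - J. a i * x i) = 0" using J by auto
    then have "sum a I = 1" using rest \<open>0 < y\<close> by auto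
    moreover have "\<forall>i\<in>I. x i = y" using \<open>J = I\<close> unfolding J_def by blast
    ultimately show False using nontrivial by blast
  qed
  then have "0 < (\<Sum>i\<in>I - J. a i * x i)"
    using assms J by (intro sum_pos) auto
  then have "sum a J < 1"
    using rest \<open>0 < y\<close> by (simp add: zero_less_mult_iff)
  then have "\<gamma> * y \<le> (\<Sum>i\<in>I - J. a i * x i)"
    unfolding rest using \<gamma>(2)[OF J(1)] \<open>0 < y\<close> by (intro mult_right_mono) auto
  then have "\<exists>j\<in>I - J. \<gamma> * y / real (card I) \<le> a j * x j"
    using assms by (intro exists_large_term) auto
  then show ?thesis by (auto simp: J_def)
qed

text \<open>A solution is recorded by the bases \<open>p\<close> and \<open>q i\<close> instead of
  the values, so that one tuple can be followed while \<alpha> varies. Nontriviality still refers to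
  the values.\<close>

definition nontrivial_tuple :: "'i set \<Rightarrow> ('i \<Rightarrow> real) \<Rightarrow> real \<Rightarrow> nat \<Rightarrow> ('i \<Rightarrow> nat) \<Rightarrow> bool" where
  "nontrivial_tuple I a \<alpha> p q \<longleftrightarrow> 1 \<le> p \<and> (\<forall>i\<in>I. 1 \<le> q i) \<and>
     real_of_int \<lfloor>real p powr \<alpha>\<rfloor> = (\<Sum>i\<in>I. a i * real_of_int \<lfloor>real (q i) powr \<alpha>\<rfloor>) \<and>
     \<not> (sum a I = 1 \<and> (\<forall>i\<in>I. \<lfloor>real (q i) powr \<alpha>\<rfloor> = \<lfloor>real p powr \<alpha>\<rfloor>))"

section \<open>Bounds for solutions given by their bases\<close>

lemma floor_ge_half:
  fixes z :: real
  assumes "1 \<le> z"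
  shows "z / 2 \<le> real_of_int \<lfloor>z\<rfloor>"
proof -
  have "1 \<le> real_of_int \<lfloor>z\<rfloor>" "z < real_of_int \<lfloor>z\<rfloor> + 1"
    using assms by (auto simp: le_floor_iff)
  then show ?thesis by linarith
qed

context
  fixes I :: "'i set" and a :: "'i \<Rightarrow> real"
  assumes finI: "finite I" and a_pos: "\<And>i. i \<in> I \<Longrightarrow> 0 < a i"
begin

text \<open>By positivity a single term of the sum is at most \<open>p powr \<alpha>\<close>. The
  constant sums all \<open>1 / a i\<close>, so that it serves every coordinate at once.\<close>

lemma nontrivial_tuple_bounded:
  assumes sol: "nontrivial_tuple I a \<alpha> p q" and "1 \<le> \<alpha>" "i \<in> I"
  shows "real (q i) \<le> (1 + (\<Sum>i\<in>I. 1 / a i)) * real p"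
proof (rule ccontr)
  define K where "K = 1 + (\<Sum>i\<in>I. 1 / a i)"
  assume "\<not> ?thesis"
  then have less: "K * real p < real (q i)" by (simp add: K_def)
  have p: "1 \<le> p" using sol by (simp add: nontrivial_tuple_def)
  have "1 / a i \<le> (\<Sum>i\<in>I. 1 / a i)"
    using a_pos finI \<open>i \<in> I\<close> by (intro member_le_sum) (auto intro: less_imp_le)
  then have K: "1 + 1 / a i \<le> K" by (simp add: K_def)
  moreover have "0 < 1 / a i" using a_pos \<open>i \<in> I\<close> by simp
  ultimately have "1 < K" by linarith
  let ?P = "real p powr \<alpha>"
  have P: "1 \<le> ?P" using p \<open>1 \<le> \<alpha>\<close> by (simp add: ge_one_powr_ge_zero)
  have "a i * \<lfloor>real (q i) powr \<alpha>\<rfloor> \<le> (\<Sum>i\<in>I. a i * real_of_int \<lfloor>real (q i) powr \<alpha>\<rfloor>)"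
    using a_pos finI \<open>i \<in> I\<close> by (intro member_le_sum) (auto intro!: mult_nonneg_nonneg intro: less_imp_le)
  also have "\<dots> = real_of_int \<lfloor>?P\<rfloor>"
    using sol by (simp add: nontrivial_tuple_def)
  also have "\<dots> \<le> ?P" by simp
  finally have "\<lfloor>real (q i) powr \<alpha>\<rfloor> \<le> 1 / a i * ?P"
    using a_pos[OF \<open>i \<in> I\<close>] by (simp add: field_simps)
  moreover have "real (q i) powr \<alpha> < \<lfloor>real (q i) powr \<alpha>\<rfloor> + 1" by linarith
  \<comment> \<open>The rounding error 1 is absorbed by
    \<open>p powr \<alpha> \<ge> 1\<close>.\<close>
  ultimately have "real (q i) powr \<alpha> < 1 / a i * ?P + ?P"
    using P by linarith
  also have "\<dots> = (1 + 1 / a i) * ?P" by (simp add: algebra_simps)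
  also have "\<dots> \<le> K powr \<alpha> * ?P"
  proof (intro mult_right_mono)
    have "K powr 1 \<le> K powr \<alpha>" using \<open>1 < K\<close> \<open>1 \<le> \<alpha>\<close> by (intro powr_mono) auto
    then show "1 + 1 / a i \<le> K powr \<alpha>" using K \<open>1 < K\<close> by simp
  qed simp
  also have "\<dots> = (K * real p) powr \<alpha>"
    using \<open>1 < K\<close> by (simp add: powr_mult)
  also have "\<dots> \<le> real (q i) powr \<alpha>"
    using less \<open>1 < K\<close> \<open>1 \<le> \<alpha>\<close> by (intro powr_mono2) auto
  finally show False by simp
qed

text \<open>Removing the floors disturbs the equation by at most \<open>1 + sum a I\<close>;
  dividing by \<open>p powr \<alpha>\<close> turns this into a bound for G - 1.\<close>

lemma nontrivial_tuple_near_one: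
  assumes sol: "nontrivial_tuple I a \<alpha> p q" and "s \<le> \<alpha>"
  shows "\<bar>power_sum I a (\<lambda>i. real (q i) / real p) \<alpha> - 1\<bar> \<le> (1 + sum a I) * real p powr - s"
proof -
  let ?P = "real p powr \<alpha>" and ?Q = "\<lambda>i. real (q i) powr \<alpha>"
  have p: "1 \<le> p" using sol by (simp add: nontrivial_tuple_def)
  have P: "0 < ?P" using p by simp
  have "\<bar>(\<Sum>i\<in>I. a i * ?Q i) - ?P\<bar> \<le> 1 + sum a I"
  proof -
    have "(\<Sum>i\<in>I. a i * real_of_int \<lfloor>?Q i\<rfloor>) \<le> (\<Sum>i\<in>I. a i * ?Q i)"
      using a_pos by (intro sum_mono mult_left_mono) (auto intro: less_imp_le)
    moreover have "(\<Sum>i\<in>I. a i * ?Q i) \<le> (\<Sum>i\<in>I. a i * (real_of_int \<lfloor>?Q i\<rfloor> + 1))"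
      using a_pos by (intro sum_mono mult_left_mono) (auto intro: less_imp_le)
    moreover have "(\<Sum>i\<in>I. a i * (real_of_int \<lfloor>?Q i\<rfloor> + 1)) = real_of_int \<lfloor>?P\<rfloor> + sum a I"
      using sol by (simp add: nontrivial_tuple_def algebra_simps sum.distrib)
    moreover have "(\<Sum>i\<in>I. a i * real_of_int \<lfloor>?Q i\<rfloor>) = real_of_int \<lfloor>?P\<rfloor>"
      using sol by (simp add: nontrivial_tuple_def)
    moreover have "0 \<le> sum a I" using a_pos by (intro sum_nonneg) (auto intro: less_imp_le)
    moreover have "real_of_int \<lfloor>?P\<rfloor> \<le> ?P" "?P \<le> real_of_int \<lfloor>?P\<rfloor> + 1" by linarith+
    ultimately show ?thesis by linarith
  qed
  moreover have "power_sum I a (\<lambda>i. real (q i) / real p) \<alpha> - 1 = ((\<Sum>i\<in>I. a i * ?Q i) - ?P) / ?P"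
    using P by (simp add: power_sum_def powr_divide diff_divide_distrib sum_divide_distrib)
  ultimately have "\<bar>power_sum I a (\<lambda>i. real (q i) / real p) \<alpha> - 1\<bar> \<le> (1 + sum a I) / ?P"
    using P by (simp add: divide_right_mono)
  also have "\<dots> = (1 + sum a I) * real p powr - \<alpha>"
    by (simp add: powr_minus_divide)
  also have "\<dots> \<le> (1 + sum a I) * real p powr - s"
    using p \<open>s \<le> \<alpha>\<close> a_pos
    by (intro mult_left_mono powr_mono add_nonneg_nonneg sum_nonneg) (auto intro: less_imp_le)
  finally show ?thesis .
qed

text \<open>The constant is chosen before \<alpha>, \<open>p\<close> and \<open>q\<close>; this
  uniformity is what later allows a single covering estimate for all tuples.\<close>

lemma nontrivial_tuple_large_coordinate:
  "\<exists>c>0. c \<le> 1 \<and> (\<forall>\<alpha>\<ge>1. \<forall>p q. nontrivial_tuple I a \<alpha> p q \<longrightarrow>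
     (\<exists>j\<in>I. q j \<noteq> p \<and> c \<le> (real (q j) / real p) powr \<alpha>))"
proof (cases "I = {}")
  case True
  have False if "1 \<le> \<alpha>" "nontrivial_tuple I a \<alpha> p q" for \<alpha> p q
  proof -
    have "1 \<le> p" "\<lfloor>real p powr \<alpha>\<rfloor> = 0"
      using that True by (auto simp: nontrivial_tuple_def)
    then show False
      using that ge_one_powr_ge_zero[of "real p" \<alpha>] by (simp add: floor_eq_iff)
  qed
  then show ?thesis by (intro exI[of _ 1]) auto
next
  case False
  obtain \<gamma> where \<gamma>: "0 < \<gamma>" "\<And>J. J \<subseteq> I \<Longrightarrow> sum a J < 1 \<Longrightarrow> \<gamma> \<le> 1 - sum a J"
    using subset_sum_gap[OF finI, of a] by blast
  define A where "A = sum a I"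
  have A: "0 < A" unfolding A_def using finI False a_pos by (intro sum_pos)
  have card: "0 < real (card I)" using finI False by (simp add: card_gt_0_iff)
  \<comment> \<open>\<open>\<gamma> / card I\<close> comes from the averaging argument, the 2 from
    comparing a floor with its argument, and \<open>A\<close> bounds the weight
    \<open>a j\<close>.\<close>
  define c where "c = \<gamma> / (2 * real (card I) * A)"
  have c: "0 < c" using \<gamma> A card by (simp add: c_def)
  have "\<exists>j\<in>I. q j \<noteq> p \<and> c \<le> (real (q j) / real p) powr \<alpha>"
    if "1 \<le> \<alpha>" and sol: "nontrivial_tuple I a \<alpha> p q" for \<alpha> p q
  proof -
    let ?P = "real p powr \<alpha>" and ?Q = "\<lambda>i. real (q i) powr \<alpha>"
    have P: "1 \<le> ?P" and Q: "\<And>i. i \<in> I \<Longrightarrow> 1 \<le> ?Q i"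
      using sol \<open>1 \<le> \<alpha>\<close> by (auto simp: nontrivial_tuple_def intro!: ge_one_powr_ge_zero)
    have "\<exists>j\<in>I. real_of_int \<lfloor>?Q j\<rfloor> \<noteq> real_of_int \<lfloor>?P\<rfloor> \<and>
        \<gamma> * real_of_int \<lfloor>?P\<rfloor> / real (card I) \<le> a j * real_of_int \<lfloor>?Q j\<rfloor>"
    proof (rule exists_large_different_coordinate[OF finI a_pos _ _ _ _ \<gamma>])
      show "0 < real_of_int \<lfloor>?P\<rfloor>" using P by simp
      show "0 < real_of_int \<lfloor>?Q i\<rfloor>" if "i \<in> I" for i using Q[OF that] by simp
      show "real_of_int \<lfloor>?P\<rfloor> = (\<Sum>i\<in>I. a i * real_of_int \<lfloor>?Q i\<rfloor>)"
        and "\<not> (sum a I = 1 \<and> (\<forall>i\<in>I. real_of_int \<lfloor>?Q i\<rfloor> = real_of_int \<lfloor>?P\<rfloor>))"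
        using sol unfolding nontrivial_tuple_def of_int_eq_iff by blast+
    qed
    then obtain j where j: "j \<in> I" "\<lfloor>?Q j\<rfloor> \<noteq> \<lfloor>?P\<rfloor>"
        "\<gamma> * real_of_int \<lfloor>?P\<rfloor> / real (card I) \<le> a j * real_of_int \<lfloor>?Q j\<rfloor>" by auto
    have "a j \<le> A"
      unfolding A_def using finI a_pos \<open>j \<in> I\<close> by (intro member_le_sum) (auto intro: less_imp_le)
    have "\<gamma> * (?P / 2) / real (card I) \<le> \<gamma> * real_of_int \<lfloor>?P\<rfloor> / real (card I)"
      using floor_ge_half[OF P] \<gamma> by (intro divide_right_mono mult_left_mono) auto
    also note j(3)
    also have "a j * real_of_int \<lfloor>?Q j\<rfloor> \<le> A * ?Q j"
      using \<open>a j \<le> A\<close> A Q[OF j(1)] by (intro mult_mono) auto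
    finally have "c * ?P \<le> ?Q j"
      using A card by (simp add: c_def field_simps)
    then have "c \<le> ?Q j / ?P"
      using sol by (subst pos_le_divide_eq) (auto simp: nontrivial_tuple_def)
    moreover have "q j \<noteq> p" using j(2) by auto
    ultimately show ?thesis using j(1) by (auto simp: powr_divide)
  qed
  \<comment> \<open>Capping at 1 gives \<open>ln c \<le> 0\<close> where the constant is
    used.\<close>
  then show ?thesis using c by (intro exI[of _ "min 1 c"]) (auto, meson min.coboundedI2)
qed

end

section \<open>Covering the exceptional parameters\<close>

text \<open>The decay rates in \<open>near_solutions_close\<close>: \<open>s - 1\<close> from the
  first derivative, and half of \<open>s - 2\<close> after taking the root of the quadratic
  bound.\<close>

definition gap_exponent :: "nat \<Rightarrow> real \<Rightarrow> real" where
  "gap_exponent n s = (if n = 1 then s - 1 else (s - 2) / 2)"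

text \<open>The sign of G' is the one bit that splits the parameters of a fixed tuple into two sets
  of small diameter.\<close>

definition increasing_at :: "'i set \<Rightarrow> ('i \<Rightarrow> real) \<Rightarrow> nat \<Rightarrow> ('i \<Rightarrow> nat) \<Rightarrow> real \<Rightarrow> bool" where
  "increasing_at I a p q \<alpha> \<longleftrightarrow> 0 \<le> power_sum_deriv I a (\<lambda>i. real (q i) / real p) \<alpha>"

context
  fixes I :: "'i set" and a :: "'i \<Rightarrow> real"
  assumes finI: "finite I" and I_ne: "I \<noteq> {}" and a_pos: "\<And>i. i \<in> I \<Longrightarrow> 0 < a i"
begin

lemma nontrivial_tuple_parameters_close:
  assumes "1 \<le> s" "s \<le> t"
  shows "\<exists>C\<ge>0. \<forall>p q. \<forall>\<alpha>\<in>{s..t}. \<forall>\<beta>\<in>{s..t}.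
    nontrivial_tuple I a \<alpha> p q \<longrightarrow> nontrivial_tuple I a \<beta> p q \<longrightarrow>
    increasing_at I a p q \<alpha> = increasing_at I a p q \<beta> \<longrightarrow>
    \<bar>\<beta> - \<alpha>\<bar> \<le> C * real p powr - gap_exponent (card I) s"
proof -
  obtain c where c: "0 < c" "c \<le> 1" and large: "\<And>\<alpha> p q. 1 \<le> \<alpha> \<Longrightarrow> nontrivial_tuple I a \<alpha> p q \<Longrightarrow>
      \<exists>j\<in>I. q j \<noteq> p \<and> c \<le> (real (q j) / real p) powr \<alpha>"
    using nontrivial_tuple_large_coordinate[of I a, OF finI a_pos] by blast
  \<comment> \<open>The distinguished index \<open>j\<close> varies with the tuple, so its weight is
    replaced by the least one.\<close>
  define b where "b = Min (a ` I)"
  have b: "0 < b" "\<And>i. i \<in> I \<Longrightarrow> b \<le> a i"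
    using finI I_ne a_pos by (auto simp: b_def)
  define K where "K = 1 + (\<Sum>i\<in>I. 1 / a i)"
  have K: "1 \<le> K"
    unfolding K_def using a_pos by (auto intro!: sum_nonneg intro: less_imp_le)
  define D where "D = 1 + sum a I"
  have D: "0 \<le> D"
    unfolding D_def using a_pos by (intro add_nonneg_nonneg sum_nonneg) (auto intro: less_imp_le)
  define B where "B = 4 * D * K\<^sup>2 * exp ((t - s) * (ln K - ln c)) / (b * c)"
  define C where "C = max (sqrt B) (2 * D * K / (b * c))"
  have "0 \<le> B" using b c D by (simp add: B_def)
  then have "0 \<le> C" by (simp add: C_def le_max_iff_disj)
  have base: "\<bar>\<beta> - \<alpha>\<bar> \<le> C * real p powr - gap_exponent (card I) s"
    if \<alpha>: "\<alpha> \<in> {s..t}" "nontrivial_tuple I a \<alpha> p q" and \<beta>: "\<beta> \<in> {s..t}" "nontrivial_tuple I a \<beta> p q"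
      and side: "0 \<le> (\<beta> - \<alpha>) * power_sum_deriv I a (\<lambda>i. real (q i) / real p) \<alpha>" for \<alpha> \<beta> p q
  proof -
    have p: "1 \<le> p" and q: "\<And>i. i \<in> I \<Longrightarrow> 1 \<le> q i"
      using \<alpha> by (auto simp: nontrivial_tuple_def)
    obtain j where j: "j \<in> I" "q j \<noteq> p" "c \<le> (real (q j) / real p) powr \<alpha>"
      using large[OF _ \<alpha>(2)] \<alpha>(1) \<open>1 \<le> s\<close> by auto
    have qj: "real (q j) \<le> K * real p"
      unfolding K_def using \<alpha> \<open>1 \<le> s\<close> j(1)
      by (intro nontrivial_tuple_bounded[of I a, OF finI a_pos \<alpha>(2)]) auto
    have near: "\<bar>power_sum I a (\<lambda>i. real (q i) / real p) x - 1\<bar> \<le> D * real p powr - s"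
      if "x \<in> {s..t}" "nontrivial_tuple I a x p q" for x
      unfolding D_def using that by (intro nontrivial_tuple_near_one[of I a, OF finI a_pos that(2)]) auto
    note close = near_solutions_close[where a = a and q = q, OF finI j(1) a_pos b(1) b(2)[OF j(1)] p q K qj j(2,3) c \<open>1 \<le> s\<close>
        \<alpha>(1) \<beta>(1) near[OF \<alpha>] near[OF \<beta>] side]
    show ?thesis
    proof (cases "card I = 1")
      case True
      then have "I = {j}" using j(1) by (auto simp: card_1_singleton_iff)
      then have "\<bar>\<beta> - \<alpha>\<bar> \<le> 2 * D * K / (b * c) * real p powr (1 - s)"
        using close(2) by simp
      also have "\<dots> \<le> C * real p powr (1 - s)"
        by (intro mult_right_mono) (auto simp: C_def)
      finally show ?thesis using True by (simp add: gap_exponent_def)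
    next
      case False
      have "(\<beta> - \<alpha>)\<^sup>2 \<le> B * real p powr (2 - s)"
        using close(1) by (simp add: B_def)
      then have "\<bar>\<beta> - \<alpha>\<bar> \<le> sqrt (B * real p powr (2 - s))"
        by (metis real_sqrt_abs real_sqrt_le_iff)
      also have "\<dots> = sqrt B * real p powr ((2 - s) / 2)"
        by (simp add: real_sqrt_mult powr_half_sqrt[symmetric] powr_powr)
      also have "\<dots> \<le> C * real p powr ((2 - s) / 2)"
        by (intro mult_right_mono) (auto simp: C_def)
      finally show ?thesis using False by (simp add: gap_exponent_def minus_divide_left)
    qed
  qed
  have "\<bar>\<beta> - \<alpha>\<bar> \<le> C * real p powr - gap_exponent (card I) s"
    if \<alpha>: "\<alpha> \<in> {s..t}" "nontrivial_tuple I a \<alpha> p q" and \<beta>: "\<beta> \<in> {s..t}" "nontrivial_tuple I a \<beta> p q"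
      and eq: "increasing_at I a p q \<alpha> = increasing_at I a p q \<beta>" for \<alpha> \<beta> p q
  proof -
    let ?d = "power_sum_deriv I a (\<lambda>i. real (q i) / real p)"
    \<comment> \<open>With both derivatives nonnegative, the smaller parameter serves as base point;
      with both negative, the larger one. Either way the sum does not decrease to first order
      towards the other parameter.\<close>
    have "0 \<le> (\<beta> - \<alpha>) * ?d \<alpha> \<or> 0 \<le> (\<alpha> - \<beta>) * ?d \<beta>"
      using eq unfolding increasing_at_def zero_le_mult_iff by linarith
    then show ?thesis
      using base[OF \<alpha> \<beta>] base[OF \<beta> \<alpha>] by (auto simp: abs_minus_commute)
  qed
  then show ?thesis using \<open>0 \<le> C\<close> by blast
qed

lemma hausdorff_measure_infinitely_many_tuples:
  assumes s: "2 < s" "s \<le> t" and d: "0 < d" "real (card I) + 1 < d * gap_exponent (card I) s"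
  shows "hausdorff_measure d {\<alpha> \<in> {s..t}. infinite {(p, q). q \<in> extensional I \<and> nontrivial_tuple I a \<alpha> p q}} = 0"
proof -
  obtain C where C: "0 \<le> C" "\<And>p q \<alpha> \<beta>. \<alpha> \<in> {s..t} \<Longrightarrow> \<beta> \<in> {s..t} \<Longrightarrow>
      nontrivial_tuple I a \<alpha> p q \<Longrightarrow> nontrivial_tuple I a \<beta> p q \<Longrightarrow>
      increasing_at I a p q \<alpha> = increasing_at I a p q \<beta> \<Longrightarrow> \<bar>\<beta> - \<alpha>\<bar> \<le> C * real p powr - gap_exponent (card I) s"
    using nontrivial_tuple_parameters_close[of s t] s by auto
  define e where "e = gap_exponent (card I) s"
  have e: "0 < e" using s by (simp add: e_def gap_exponent_def)
  define \<rho> where "\<rho> p = C * real p powr - e" for p :: nat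
  define K where "K = 1 + (\<Sum>i\<in>I. 1 / a i)"
  have K: "1 \<le> K"
    unfolding K_def using a_pos by (auto intro!: sum_nonneg intro: less_imp_le)
  \<comment> \<open>A finite box holding every \<open>q\<close> that can occur with
    \<open>p\<close>, by \<open>nontrivial_tuple_bounded\<close>.\<close>
  define T where "T p = I \<rightarrow>\<^sub>E {..nat \<lfloor>K * real p\<rfloor>}" for p
  have finT: "finite (T p)" for p
    unfolding T_def using finI by (intro finite_PiE) auto
  have T: "q \<in> T p" if "q \<in> extensional I" "nontrivial_tuple I a \<alpha> p q" "\<alpha> \<in> {s..t}" for \<alpha> p q
    using nontrivial_tuple_bounded[of I a, OF finI a_pos that(2)] that s
    by (auto simp: T_def PiE_def K_def le_nat_floor)
  define V where "V p = (\<lambda>(q, b). {\<alpha> \<in> {s..t}. nontrivial_tuple I a \<alpha> p q \<and> increasing_at I a p q \<alpha> = b})" for p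
  define \<V> where "\<V> p = V p ` (T p \<times> UNIV)" for p
  define N where "N = card I"
  show ?thesis
  proof (rule hausdorff_measure_limsup_eq_0[OF d(1)])
    show "finite (\<V> p)" for p
      unfolding \<V>_def using finT by (intro finite_imageI finite_cartesian_product) auto
  next
    fix p W assume "W \<in> \<V> p"
    then obtain q b where W: "W = V p (q, b)" by (auto simp: \<V>_def)
    have "bounded W"
      by (rule bounded_subset[of "{s..t}"]) (auto simp: W V_def)
    moreover have "diameter W \<le> \<rho> p"
    proof (rule diameter_le)
      show "W \<noteq> {} \<or> 0 \<le> \<rho> p" using C(1) by (simp add: \<rho>_def)
      show "norm (x - y) \<le> \<rho> p" if "x \<in> W" "y \<in> W" for x y
        using that C(2)[of y x p q] by (simp add: W V_def \<rho>_def e_def)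
    qed
    ultimately show "bounded W \<and> diameter W \<le> \<rho> p" by blast
  next
    have "(\<lambda>p. C * real p powr - e) \<longlonglongrightarrow> C * 0"
      using e by (intro tendsto_mult tendsto_const tendsto_neg_powr filterlim_real_sequentially) auto
    then show "\<rho> \<longlonglongrightarrow> 0" by (simp add: \<rho>_def[abs_def])
  next
    have card: "real (card (\<V> p)) \<le> 2 * (2 * K) ^ N * real p powr N" if "1 \<le> p" for p
    proof -
      have "card (\<V> p) \<le> card (T p \<times> (UNIV :: bool set))"
        unfolding \<V>_def using finT by (intro card_image_le) auto
      \<comment> \<open>The 2 counts the sign bit, and \<open>Suc\<close> appears because the box
        contains 0. The additional 1 is absorbed below by \<open>K * p \<ge> 1\<close>.\<close>
      also have "\<dots> = 2 * Suc (nat \<lfloor>K * real p\<rfloor>) ^ N"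
        using finI by (simp add: T_def card_PiE card_cartesian_product N_def)
      finally have "real (card (\<V> p)) \<le> real (2 * Suc (nat \<lfloor>K * real p\<rfloor>) ^ N)"
        by (rule of_nat_mono)
      also have "\<dots> = 2 * (real (nat \<lfloor>K * real p\<rfloor>) + 1) ^ N" by (simp add: add.commute)
      also have "\<dots> \<le> 2 * (2 * K * real p) ^ N"
      proof (intro mult_left_mono power_mono)
        have "1 * 1 \<le> K * real p" using K that by (intro mult_mono) auto
        then show "real (nat \<lfloor>K * real p\<rfloor>) + 1 \<le> 2 * K * real p" by linarith
      qed auto
      finally show ?thesis using that by (simp add: power_mult_distrib powr_realpow mult_ac)
    qed
    \<comment> \<open>The exponent \<open>N - d * e\<close> is below -1 exactly by the second
      assumption on \<open>d\<close>.\<close>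
    have "summable (\<lambda>p. 2 * (2 * K) ^ N * C powr d * real p powr (N - d * e))"
      using d by (intro summable_mult) (simp add: summable_real_powr_iff N_def e_def)
    then show "summable (\<lambda>p. real (card (\<V> p)) * \<rho> p powr d)"
    proof (rule summable_comparison_test[rotated], intro exI[of _ 1] allI impI)
      fix p :: nat assume "1 \<le> p"
      have "real (card (\<V> p)) * \<rho> p powr d \<le> (2 * (2 * K) ^ N * real p powr N) * \<rho> p powr d"
        using card[OF \<open>1 \<le> p\<close>] by (rule mult_right_mono) simp
      also have "\<dots> = 2 * (2 * K) ^ N * C powr d * (real p powr N * real p powr (- e * d))"
        using C(1) by (simp add: \<rho>_def powr_mult powr_powr)
      also have "real p powr N * real p powr (- e * d) = real p powr (N - d * e)"
        by (simp flip: powr_add add: mult_ac)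
      finally show "norm (real (card (\<V> p)) * \<rho> p powr d) \<le> 2 * (2 * K) ^ N * C powr d * real p powr (N - d * e)"
        by simp
    qed
  next
    fix \<alpha> assume "\<alpha> \<in> {\<alpha> \<in> {s..t}. infinite {(p, q). q \<in> extensional I \<and> nontrivial_tuple I a \<alpha> p q}}"
    then have \<alpha>: "\<alpha> \<in> {s..t}" and inf: "infinite {(p, q). q \<in> extensional I \<and> nontrivial_tuple I a \<alpha> p q}"
      by auto
    show "infinite {p. \<alpha> \<in> \<Union>(\<V> p)}"
    proof
      assume fin: "finite {p. \<alpha> \<in> \<Union>(\<V> p)}"
      \<comment> \<open>Each \<open>p\<close> admits only finitely many \<open>q\<close>, so
        infinitely many tuples must involve infinitely many \<open>p\<close>.\<close>
      have "{(p, q). q \<in> extensional I \<and> nontrivial_tuple I a \<alpha> p q} \<subseteq> Sigma {p. \<alpha> \<in> \<Union>(\<V> p)} T"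
      proof clarify
        fix p q assume pq: "q \<in> extensional I" "nontrivial_tuple I a \<alpha> p q"
        have "\<alpha> \<in> V p (q, increasing_at I a p q \<alpha>)" using pq \<alpha> by (simp add: V_def)
        moreover have "V p (q, increasing_at I a p q \<alpha>) \<in> \<V> p"
          unfolding \<V>_def using T[OF pq \<alpha>] by blast
        ultimately show "p \<in> {p. \<alpha> \<in> \<Union>(\<V> p)} \<and> q \<in> T p" using T[OF pq \<alpha>] by blast
      qed
      from finite_subset[OF this finite_SigmaI[OF fin finT]] inf show False by contradiction
    qed
  qed
qed

end

section \<open>Return to the equation in \<open>PS \<alpha>\<close>\<close>

lemma infinite_tuples_of_infinite_solutions:
  assumes "infinite (nontrivial_PS_solutions \<alpha> n a)"
  shows "infinite {(p, q). q \<in> extensional {1..n} \<and> nontrivial_tuple {1..n} a \<alpha> p q}"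
proof
  assume fin: "finite {(p, q). q \<in> extensional {1..n} \<and> nontrivial_tuple {1..n} a \<alpha> p q}" (is "finite ?T")
  define F where "F = (\<lambda>(p :: nat, q :: nat \<Rightarrow> nat).
    (\<lfloor>real p powr \<alpha>\<rfloor>, \<lambda>i\<in>{1..n}. \<lfloor>real (q i) powr \<alpha>\<rfloor>))"
  \<comment> \<open>Choosing a base for each coordinate exhibits every solution as an image under
    \<open>F\<close>, so finitely many tuples would leave finitely many solutions.\<close>
  have "nontrivial_PS_solutions \<alpha> n a \<subseteq> F ` ?T"
  proof
    fix z assume "z \<in> nontrivial_PS_solutions \<alpha> n a"
    then obtain y x where z: "z = (y, x)" and y: "y \<in> PS \<alpha>" and x: "x \<in> {1..n} \<rightarrow>\<^sub>E PS \<alpha>"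
        and eq: "real_of_int y = (\<Sum>i=1..n. a i * real_of_int (x i))"
        and nontrivial: "\<not> (sum a {1..n} = 1 \<and> (\<forall>i\<in>{1..n}. x i = y))"
      by (auto simp: nontrivial_PS_solutions_def PS_solutions_def trivial_solution_def)
    obtain p where p: "1 \<le> p" "y = \<lfloor>real p powr \<alpha>\<rfloor>" using y by (auto simp: PS_def)
    have "\<forall>i\<in>{1..n}. \<exists>m. 1 \<le> m \<and> x i = \<lfloor>real m powr \<alpha>\<rfloor>"
      using x by (fastforce simp: PS_def PiE_iff)
    then obtain q' where q': "\<And>i. i \<in> {1..n} \<Longrightarrow> 1 \<le> q' i \<and> x i = \<lfloor>real (q' i) powr \<alpha>\<rfloor>"
      by metis
    define q where "q = restrict q' {1..n}"
    have q: "1 \<le> q i" "x i = \<lfloor>real (q i) powr \<alpha>\<rfloor>" if "i \<in> {1..n}" for i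
      using q'[OF that] that by (auto simp: q_def)
    have "z = F (p, q)"
      using x p q by (auto simp: z F_def PiE_iff intro!: extensionalityI[of x "{1..n}"])
    moreover have "nontrivial_tuple {1..n} a \<alpha> p q"
      unfolding nontrivial_tuple_def using p q eq nontrivial by simp
    moreover have "q \<in> extensional {1..n}" by (simp add: q_def)
    ultimately show "z \<in> F ` ?T" by blast
  qed
  then show False using assms fin finite_surj by blast
qed

text \<open>The value \<open>d = 3n / (s - 4)\<close> is itself allowed, so the dimension bound
  follows without a limit in \<open>d\<close>.\<close>

lemma hausdorff_measure_infinite_solutions:
  fixes n :: nat
  assumes n: "1 \<le> n" and a: "\<And>i. i \<in> {1..n} \<Longrightarrow> 0 < a i"
    and s: "3 * real n + 4 < s" "s \<le> t" and d: "3 * real n / (s - 4) \<le> d"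
  shows "hausdorff_measure d {\<alpha> \<in> {s..t}. infinite (nontrivial_PS_solutions \<alpha> n a)} = 0"
proof -
  have "0 < s - 4" using s n by simp
  then have ds: "3 * real n \<le> d * (s - 4)" using d by (simp add: pos_divide_le_eq)
  have "0 < 3 * real n / (s - 4)" using \<open>0 < s - 4\<close> n by simp
  then have "0 < d" using d by linarith
  have "real n + 1 < d * gap_exponent n s"
  \<comment> \<open>For \<open>n = 1\<close>, 2 < 3 \<le> d * (s - 1). For \<open>n \<ge> 2\<close>,
    n + 1 \<le> 3n / 2 < d * (s - 2) / 2.\<close>
  proof (cases "n = 1")
    case True
    have "d * (s - 4) \<le> d * (s - 1)" using \<open>0 < d\<close> by (intro mult_left_mono) auto
    then show ?thesis using ds True by (simp add: gap_exponent_def)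
  next
    case False
    then have "2 \<le> n" using n by simp
    moreover have "d * (s - 4) < d * (s - 2)" using \<open>0 < d\<close> by (intro mult_strict_left_mono) auto
    ultimately show ?thesis using ds False by (simp add: gap_exponent_def)
  qed
  then have "hausdorff_measure d {\<alpha> \<in> {s..t}.
      infinite {(p, q). q \<in> extensional {1..n} \<and> nontrivial_tuple {1..n} a \<alpha> p q}} = 0"
    using n a s \<open>0 < d\<close> by (intro hausdorff_measure_infinitely_many_tuples) simp_all
  then show ?thesis
    by (rule hausdorff_measure_eq_0_subset) (use infinite_tuples_of_infinite_solutions in auto)
qed

theorem theorem2p2:
  fixes n :: nat and a :: "nat \<Rightarrow> real"
  assumes "n \<ge> 1"
    and "\<And>i. i \<in> {1..n} \<Longrightarrow> a i > 0"
  shows "(\<forall>s t :: real. 3 * real n + 4 < s \<and> s < t \<longrightarrow>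
            hausdorff_dim {\<alpha> \<in> {s..t}. infinite (nontrivial_PS_solutions \<alpha> n a)}
              \<le> ennreal (3 * real n / (s - 4)))
       \<and> (AE \<alpha> in lebesgue. \<alpha> > 3 * real n + 4 \<longrightarrow>
            finite (nontrivial_PS_solutions \<alpha> n a))"
proof (intro conjI allI impI)
  fix s t :: real assume st: "3 * real n + 4 < s \<and> s < t"
  then show "hausdorff_dim {\<alpha> \<in> {s..t}. infinite (nontrivial_PS_solutions \<alpha> n a)}
      \<le> ennreal (3 * real n / (s - 4))"
    by (intro hausdorff_dim_le hausdorff_measure_infinite_solutions assms) auto
next
  \<comment> \<open>Compact intervals exhausting the open half-line; each left endpoint stays
    strictly above \<open>3n + 4\<close>, as the covering result requires.\<close>
  define E where "E k = {\<alpha> \<in> {3 * real n + 4 + 1 / (real k + 1)..3 * real n + 6 + real k}.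
    infinite (nontrivial_PS_solutions \<alpha> n a)}" for k :: nat
  have "negligible (E k)" for k
  proof (rule negligible_if_hausdorff_measure_1_eq_0, unfold E_def,
      rule hausdorff_measure_infinite_solutions)
    have pos: "0 < 1 / (real k + 1)" and "1 / (real k + 1) \<le> 1" by auto
    then show "3 * real n + 4 + 1 / (real k + 1) \<le> 3 * real n + 6 + real k" by linarith
    \<comment> \<open>At the left endpoint \<open>s - 4\<close> exceeds \<open>3n\<close>, so
      exponent 1 is admissible, and null sets for it are Lebesgue null.\<close>
    show "3 * real n / (3 * real n + 4 + 1 / (real k + 1) - 4) \<le> 1"
      using pos assms(1) by (subst divide_le_eq_1_pos) linarith+
  qed (use assms in auto)
  then have "negligible (\<Union>k. E k)"
    by (intro negligible_countable_Union) auto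
  then have null: "(\<Union>k. E k) \<in> null_sets lebesgue"
    by (simp add: negligible_iff_null_sets)
  show "AE \<alpha> in lebesgue. \<alpha> > 3 * real n + 4 \<longrightarrow> finite (nontrivial_PS_solutions \<alpha> n a)"
  proof (rule AE_I'[OF null], clarsimp)
    fix \<alpha> assume \<alpha>: "3 * real n + 4 < \<alpha>" "infinite (nontrivial_PS_solutions \<alpha> n a)"
    define \<delta> where "\<delta> = \<alpha> - (3 * real n + 4)"
    have "0 < \<delta>" using \<alpha> by (simp add: \<delta>_def)
    \<comment> \<open>\<open>k > 1 / \<delta>\<close> puts the left endpoint below \<alpha>, and
      \<open>k > \<alpha>\<close> the right endpoint above it.\<close>
    obtain k :: nat where k: "max (1 / \<delta>) \<alpha> < real k" using reals_Archimedean2 by blast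
    then have "1 / (real k + 1) \<le> \<delta>" using \<open>0 < \<delta>\<close> by (simp add: field_simps)
    then have "\<alpha> \<in> E k" using \<alpha> k by (auto simp: E_def \<delta>_def)
    then show "\<exists>k. \<alpha> \<in> E k" by blast
  qed
qed

end
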